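(* Let $W,H$ be real Hilbert spaces with a dense and continuous inclusion $W\hookrightarrow H$, let $I=[0,1]$, and let $\mathcal{A}:I\rightarrow\mathcal{FS}(W,H)\subset\mathcal{L}(W,H)$ be a continuously differentiable path. Then there exists $\varepsilon>0$ such that i) $\mathcal{A}+\delta I_H$ is a path in $\mathcal{FS}(W,H)$ for all $|\delta|<\varepsilon$; ii) $\mathcal{A}+\delta I_H$ has only regular crossings for almost every $\delta\in(-\varepsilon,\varepsilon)$.
   Context: $\mathcal{L}(W,H)$ is the Banach space of bounded operators from $W$ to $H$; $\mathcal{FS}(W,H)\subset\mathcal{L}(W,H)$ is the set of those operators that are selfadjoint when regarded as operators on $H$ with dense domain $W$, and Fredholm. $I_H$ is the identity of $H$ (viewed, by restriction to $W$, as an element of $\mathcal{L}(W,H)$), and $(\mathcal{A}+\delta I_H)_t=\mathcal{A}_t+\delta I_H$. "Almost every" is with respect to Lebesgue measure. For a continuously differentiable path $\mathcal{A}:I\to\mathcal{FS}(W,H)$ with derivative $\dot{\mathcal{A}}_{t}$, an instant $t_0\in I$ is a crossing if $\ker\mathcal{A}_{t_0}\neq0$. The crossing form at $t_0$ is the quadratic form $\Gamma(\mathcal{A},t_0):\ker\mathcal{A}_{t_0}\to\mathbb{R}$, $\Gamma(\mathcal{A},t_0)[u]=\langle\dot{\mathcal{A}}_{t_0}u,u\rangle_H$. A crossing $t_0$ is regular if $\Gamma(\mathcal{A},t_0)$ is non-degenerate. *)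

theory Defs
  imports "HOL-Analysis.Analysis"
begin

text \<open>
  The continuous inclusion of \<open>W\<close> into \<open>H\<close> is an injective bounded linear map
  \<open>j :: 'w \<Rightarrow>\<^sub>L 'h\<close>, whose range is \<open>W\<close> as a subset of \<open>H\<close>. An element \<open>T\<close> of \<open>L(W,H)\<close>,
  regarded as an operator on \<open>H\<close> with domain \<open>W\<close>, is then represented by its graph
  in \<open>H \<times> H\<close>; the identity of \<open>H\<close>, restricted to \<open>W\<close>, is \<open>j\<close> itself.
\<close>

definition op_graph :: "('w::real_inner \<Rightarrow>\<^sub>L 'h::real_inner) \<Rightarrow> ('w \<Rightarrow>\<^sub>L 'h) \<Rightarrow> ('h \<times> 'h) set" where
  "op_graph j T = {(blinfun_apply j u, blinfun_apply T u) | u. True}"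

text \<open>
  If the domain of the operator with graph \<open>G\<close> is dense, this is the graph of its
  Hilbert space adjoint: \<open>v\<close> is in the domain of the adjoint, with value \<open>z\<close>, iff
  \<open>\<langle>Tx, v\<rangle> = \<langle>x, z\<rangle>\<close> for all \<open>x\<close> in the domain of \<open>T\<close>.
\<close>

definition adjoint_graph :: "('h::real_inner \<times> 'h) set \<Rightarrow> ('h \<times> 'h) set" where
  "adjoint_graph G = {(v, z). \<forall>(x, y) \<in> G. y \<bullet> v = x \<bullet> z}"

definition selfadjoint_op :: "('w::real_inner \<Rightarrow>\<^sub>L 'h::real_inner) \<Rightarrow> ('w \<Rightarrow>\<^sub>L 'h) \<Rightarrow> bool" where
  "selfadjoint_op j T \<longleftrightarrow> adjoint_graph (op_graph j T) = op_graph j T"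

definition blinfun_kernel :: "('a::real_normed_vector \<Rightarrow>\<^sub>L 'b::real_normed_vector) \<Rightarrow> 'a set" where
  "blinfun_kernel T = {u. blinfun_apply T u = 0}"

text \<open>
  Finite-dimensional kernel, closed range, finite-dimensional cokernel. Between Banach
  spaces closedness of the range follows from the other two conditions.
\<close>

definition fredholm :: "('a::real_normed_vector \<Rightarrow>\<^sub>L 'b::real_normed_vector) \<Rightarrow> bool" where
  "fredholm T \<longleftrightarrow>
     (\<exists>B. finite B \<and> span B = blinfun_kernel T) \<and>
     closed (range (blinfun_apply T)) \<and>
     (\<exists>C. finite C \<and> span (range (blinfun_apply T) \<union> C) = UNIV)"

definition FS :: "('w::real_inner \<Rightarrow>\<^sub>L 'h::real_inner) \<Rightarrow> ('w \<Rightarrow>\<^sub>L 'h) set" where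
  "FS j = {T. selfadjoint_op j T \<and> fredholm T}"

text \<open>
  One-sided derivatives at the endpoints; the library's \<open>C1_differentiable_on\<close> would
  instead depend on values of the path outside the unit interval.
\<close>

definition C1_path :: "(real \<Rightarrow> 'a::real_normed_vector) \<Rightarrow> bool" where
  "C1_path A \<longleftrightarrow>
     (\<exists>A'. (\<forall>t\<in>{0..1}. (A has_vector_derivative A' t) (at t within {0..1})) \<and>
           continuous_on {0..1} A')"

definition path_deriv :: "(real \<Rightarrow> 'a::real_normed_vector) \<Rightarrow> real \<Rightarrow> 'a" where
  "path_deriv A t = vector_derivative A (at t within {0..1})"

definition crossing :: "(real \<Rightarrow> 'w::real_inner \<Rightarrow>\<^sub>L 'h::real_inner) \<Rightarrow> real \<Rightarrow> bool" where
  "crossing A t \<longleftrightarrow> t \<in> {0..1} \<and> blinfun_kernel (A t) \<noteq> {0}"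

definition crossing_form ::
  "('w::real_inner \<Rightarrow>\<^sub>L 'h::real_inner) \<Rightarrow> (real \<Rightarrow> 'w \<Rightarrow>\<^sub>L 'h) \<Rightarrow> real \<Rightarrow> 'w \<Rightarrow> real" where
  "crossing_form j A t u = blinfun_apply (path_deriv A t) u \<bullet> blinfun_apply j u"

text \<open>
  The polar form of a quadratic form, and non-degeneracy on a subspace as triviality
  of the radical of the polar form.
\<close>

definition polar_form :: "('a::real_vector \<Rightarrow> real) \<Rightarrow> 'a \<Rightarrow> 'a \<Rightarrow> real" where
  "polar_form Q u v = (Q (u + v) - Q u - Q v) / 2"

definition nondegenerate_on :: "'a::real_vector set \<Rightarrow> ('a \<Rightarrow> real) \<Rightarrow> bool" where
  "nondegenerate_on V Q \<longleftrightarrow> (\<forall>u\<in>V. (\<forall>v\<in>V. polar_form Q u v = 0) \<longrightarrow> u = 0)"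

definition regular_crossing ::
  "('w::real_inner \<Rightarrow>\<^sub>L 'h::real_inner) \<Rightarrow> (real \<Rightarrow> 'w \<Rightarrow>\<^sub>L 'h) \<Rightarrow> real \<Rightarrow> bool" where
  "regular_crossing j A t \<longleftrightarrow>
     crossing A t \<and> nondegenerate_on (blinfun_kernel (A t)) (crossing_form j A t)"

definition only_regular_crossings ::
  "('w::real_inner \<Rightarrow>\<^sub>L 'h::real_inner) \<Rightarrow> (real \<Rightarrow> 'w \<Rightarrow>\<^sub>L 'h) \<Rightarrow> bool" where
  "only_regular_crossings j A \<longleftrightarrow> (\<forall>t. crossing A t \<longrightarrow> regular_crossing j A t)"

definition shift_path ::
  "('w::real_inner \<Rightarrow>\<^sub>L 'h::real_inner) \<Rightarrow> (real \<Rightarrow> 'w \<Rightarrow>\<^sub>L 'h) \<Rightarrow> real \<Rightarrow> (real \<Rightarrow> 'w \<Rightarrow>\<^sub>L 'h)" where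
  "shift_path j A \<delta> = (\<lambda>t. A t + \<delta> *\<^sub>R j)"

end

theory Submission
  imports Defs
begin

text \<open>
  The Fredholm operators form an open set, so by compactness of the path there is a uniform
  \<open>\<epsilon>\<close>; shifting by \<open>\<delta>\<close> clearly preserves selfadjointness.

  For (ii), no spectral decomposition is needed. Let \<open>G\<close> be the set of \<open>(t, \<delta>)\<close> for which
  \<open>A\<^sub>t + \<delta>\<close> has a kernel vector \<open>u \<noteq> 0\<close> with \<open>\<langle>A'\<^sub>t u, u\<rangle> = 0\<close>; every \<open>\<delta>\<close> with a degenerate
  crossing lies in the second projection of \<open>G\<close>. If points \<open>(s, d)\<close> of \<open>G\<close>, with unit kernel
  vectors \<open>u\<^sub>s\<close>, tend to \<open>(t, \<delta>)\<close>, the Fredholm property makes a subsequence of \<open>u\<^sub>s\<close> converge to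
  some \<open>l\<close> in the kernel of \<open>A\<^sub>t + \<delta>\<close>, and by symmetry
  \<open>\<langle>(A\<^sub>s - A\<^sub>t) u\<^sub>s, l\<rangle> = - (d - \<delta>) \<langle>u\<^sub>s, l\<rangle>\<close>. Since \<open>\<langle>A'\<^sub>t l, l\<rangle> = lim \<langle>A'\<^sub>s u\<^sub>s, u\<^sub>s\<rangle> = 0\<close>, this gives
  \<open>(d - \<delta>) / (s - t) \<longlonglongrightarrow> 0\<close>. Hence \<open>G\<close> is a countable union of graphs of functions of \<open>t\<close> with
  vanishing derivative, whose images are null sets by Sard's lemma.
\<close>

section \<open>Bounded liftings and stability of the Fredholm property\<close>

text \<open>Compactness appears as a hypothesis so that the induction in the next lemma can feed its
  own induction hypothesis to it.\<close>

lemma closed_if_bounded_sequentially_compact: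
  fixes S :: "'a::real_normed_vector set"
  assumes "\<And>x K. (\<And>n. x n \<in> S) \<Longrightarrow> (\<And>n::nat. norm (x n) \<le> K) \<Longrightarrow>
    \<exists>l r. l \<in> S \<and> strict_mono (r :: nat \<Rightarrow> nat) \<and> (x \<circ> r) \<longlonglongrightarrow> l"
  shows "closed S"
  unfolding closed_sequential_limits
proof (intro allI impI, elim conjE)
  fix x l assume x: "\<forall>n. x n \<in> S" "x \<longlonglongrightarrow> l"
  then obtain K where "\<And>n. norm (x n) \<le> K"
    by (metis Bseq_def convergentI convergent_imp_Bseq)
  with assms[of x K] x(1) obtain l' r where l': "l' \<in> S" "strict_mono (r :: nat \<Rightarrow> nat)" "(x \<circ> r) \<longlonglongrightarrow> l'"
    by blast
  then show "l \<in> S"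
    using LIMSEQ_subseq_LIMSEQ LIMSEQ_unique x(2) by blast
qed

text \<open>Induction on \<open>B\<close>. The induction hypothesis makes \<open>span B\<close>
  closed, so a new vector \<open>b\<close> outside it has positive distance \<open>d\<close> from
  it. This bounds the coefficients of \<open>b\<close> by \<open>K / d\<close>, and
  Bolzano-Weierstrass handles them before the induction hypothesis handles the rest.\<close>

lemma span_finite_sequentially_compact:
  fixes B :: "'a::real_normed_vector set" and x :: "nat \<Rightarrow> 'a"
  assumes "finite B" "\<And>n. x n \<in> span B" "\<And>n. norm (x n) \<le> K"
  obtains l r where "l \<in> span B" "strict_mono r" "(x \<circ> r) \<longlonglongrightarrow> l"
proof -
  have "\<exists>l r. l \<in> span B \<and> strict_mono (r :: nat \<Rightarrow> nat) \<and> (x \<circ> r) \<longlonglongrightarrow> l"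
    using assms
  proof (induction B arbitrary: x K rule: finite_induct)
    case empty
    then have "x = (\<lambda>n. 0)" by auto
    then show ?case
      by (intro exI[of _ 0] exI[of _ id]) (auto simp: strict_mono_def)
  next
    case (insert b B)
    show ?case
    proof (cases "b \<in> span B")
      case True
      then show ?thesis
        using insert.IH[of x K] insert.prems by (simp add: span_redundant)
    next
      case False
      have cl: "closed (span B)"
        using insert.IH by (rule closed_if_bounded_sequentially_compact)
      define d where "d = infdist b (span B)"
      have d: "d > 0"
        unfolding d_def using cl False span_zero by (intro infdist_pos_not_in_closed) auto
      \<comment> \<open>After division by \<open>a\<close> the right side is the distance from
        \<open>b\<close> to a point of \<open>span B\<close>.\<close>
      have lower: "\<bar>a\<bar> * d \<le> norm (a *\<^sub>R b + y)" if "y \<in> span B" for a y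
      proof (cases "a = 0")
        case False
        have "- (1/a) *\<^sub>R y \<in> span B"
          using that by (rule span_scale)
        then have "d \<le> dist b (- (1/a) *\<^sub>R y)"
          unfolding d_def by (rule infdist_le)
        then have "\<bar>a\<bar> * d \<le> \<bar>a\<bar> * norm (b + (1/a) *\<^sub>R y)"
          by (intro mult_left_mono) (auto simp: dist_norm)
        also have "\<dots> = norm (a *\<^sub>R (b + (1/a) *\<^sub>R y))"
          by simp
        finally show ?thesis
          using False by (simp add: algebra_simps)
      qed auto
      have "\<forall>n. \<exists>a. x n - a *\<^sub>R b \<in> span B"
        using insert.prems(1) span_breakdown_eq by blast
      then obtain a where a: "\<And>n. x n - a n *\<^sub>R b \<in> span B"
        by metis
      have abound: "\<bar>a n\<bar> \<le> K / d" for n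
      proof -
        have "\<bar>a n\<bar> * d \<le> norm (x n)"
          using lower[OF a, of "a n" n] by simp
        also have "\<dots> \<le> K"
          by (rule insert.prems)
        finally show ?thesis
          using d by (simp add: field_simps)
      qed
      then have "bounded (range a)"
        by (auto simp: bounded_iff)
      then obtain la r where r: "strict_mono (r :: nat \<Rightarrow> nat)" "(a \<circ> r) \<longlonglongrightarrow> la"
        using bounded_imp_convergent_subsequence by blast
      define y where "y n = x (r n) - a (r n) *\<^sub>R b" for n
      have "norm (y n) \<le> K + K / d * norm b" for n
      proof -
        have "norm (y n) \<le> norm (x (r n)) + \<bar>a (r n)\<bar> * norm b"
          unfolding y_def by (metis norm_scaleR norm_triangle_ineq4)
        also have "\<dots> \<le> K + K / d * norm b"
          by (intro add_mono insert.prems mult_right_mono abound) auto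
        finally show ?thesis .
      qed
      moreover have "y n \<in> span B" for n
        unfolding y_def by (rule a)
      ultimately obtain l s where l: "l \<in> span B" "strict_mono (s :: nat \<Rightarrow> nat)" "(y \<circ> s) \<longlonglongrightarrow> l"
        using insert.IH[of y] by blast
      have "(\<lambda>n. (y \<circ> s) n + ((a \<circ> r) \<circ> s) n *\<^sub>R b) \<longlonglongrightarrow> l + la *\<^sub>R b"
        by (intro tendsto_intros l LIMSEQ_subseq_LIMSEQ[OF r(2) l(2)])
      then have "(x \<circ> (r \<circ> s)) \<longlonglongrightarrow> l + la *\<^sub>R b"
        by (simp add: y_def o_def)
      moreover have "l + la *\<^sub>R b \<in> span (insert b B)"
        using l(1) by (auto simp: span_breakdown_eq intro!: exI[of _ la])
      ultimately show ?thesis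
        using strict_mono_o[OF r(1) l(2)] by blast
    qed
  qed
  then show thesis
    using that by blast
qed

lemma closed_span_finite:
  fixes B :: "'a::real_normed_vector set"
  assumes "finite B"
  shows "closed (span B)"
proof (rule closed_if_bounded_sequentially_compact)
  fix x :: "nat \<Rightarrow> 'a" and K
  assume "\<And>n. x n \<in> span B" "\<And>n. norm (x n) \<le> K"
  then obtain l r where "l \<in> span B" "strict_mono r" "(x \<circ> r) \<longlonglongrightarrow> l"
    by (rule span_finite_sequentially_compact[OF assms])
  then show "\<exists>l r. l \<in> span B \<and> strict_mono (r :: nat \<Rightarrow> nat) \<and> (x \<circ> r) \<longlonglongrightarrow> l"
    by blast
qed

text \<open>Greedy choice: \<open>c\<close> is kept only if it lies outside the span of
  \<open>R\<close> and the vectors kept so far. Then a vector of \<open>R\<close> cannot involve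
  \<open>c\<close> with nonzero coefficient, so the intersection stays trivial.\<close>

lemma finite_complement_of_subspace:
  fixes R C :: "'a::real_vector set"
  assumes "subspace R" "finite C"
  obtains C' where "C' \<subseteq> C" "span (R \<union> C') = span (R \<union> C)" "R \<inter> span C' = {0}"
proof -
  have "\<exists>C'\<subseteq>C. span (R \<union> C') = span (R \<union> C) \<and> R \<inter> span C' = {0}"
    using assms(2)
  proof (induction C rule: finite_induct)
    case empty
    have "R \<inter> span {} = {0}"
      using subspace_0[OF assms(1)] by simp
    then show ?case
      by blast
  next
    case (insert c C)
    from insert.IH obtain C' where C': "C' \<subseteq> C" "span (R \<union> C') = span (R \<union> C)" "R \<inter> span C' = {0}"
      by (elim exE conjE)
    have eq: "span (R \<union> insert c C') = span (R \<union> insert c C)"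
      using C'(2) by (simp add: span_insert)
    show ?case
    proof (cases "c \<in> span (R \<union> C')")
      case True
      then have "span (R \<union> C') = span (R \<union> insert c C)"
        using eq by (simp add: span_redundant)
      then show ?thesis
        using C' by blast
    next
      case False
      have "v = 0" if v: "v \<in> R" "v \<in> span (insert c C')" for v
      proof -
        obtain a where a: "v - a *\<^sub>R c \<in> span C'"
          using v(2) span_breakdown_eq by blast
        have "a = 0"
        proof (rule ccontr)
          assume "a \<noteq> 0"
          have "v \<in> span (R \<union> C')" "v - a *\<^sub>R c \<in> span (R \<union> C')"
            using v(1) a span_mono[of C' "R \<union> C'"] by (auto intro: span_base)
          then have "(1/a) *\<^sub>R (v - (v - a *\<^sub>R c)) \<in> span (R \<union> C')"
            by (rule span_scale[OF span_diff])
          then show False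
            using False \<open>a \<noteq> 0\<close> by simp
        qed
        then show ?thesis
          using a v(1) C'(3) by auto
      qed
      then have "R \<inter> span (insert c C') = {0}"
        using subspace_0[OF assms(1)] span_zero by blast
      then show ?thesis
        using C'(1) eq by (intro exI[of _ "insert c C'"]) auto
    qed
  qed
  then show thesis
    by (elim exE conjE) (rule that)
qed

section \<open>Bounded solutions of \<open>y = T x\<close> modulo a closed subspace\<close>

text \<open>Lifting the remaining defect again and again halves it each time, so the lifts are
  dominated by a geometric series with sum \<open>2 * k * norm y\<close>. This step serves both the
  open mapping theorem and the perturbation of cokernels.\<close>

lemma lifting_of_approximate_lifting:
  fixes T :: "'a::banach \<Rightarrow>\<^sub>L 'b::real_normed_vector"
  assumes M: "subspace M" "closed M" and "k \<ge> 0"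
    and approx: "\<And>y. \<exists>x. \<exists>m\<in>M. norm x \<le> k * norm y \<and> norm (y - T x - m) \<le> norm y / 2"
  shows "\<exists>x. y - T x \<in> M \<and> norm x \<le> 2 * k * norm y"
proof -
  obtain X m where m: "\<And>y. m y \<in> M" and X: "\<And>y. norm (X y) \<le> k * norm y"
    and res: "\<And>y. norm (y - T (X y) - m y) \<le> norm y / 2"
    using approx by metis
  define z where "z n = ((\<lambda>y. y - T (X y) - m y) ^^ n) y" for n
  have z_Suc: "z (Suc n) = z n - T (X (z n)) - m (z n)" and z_0: "z 0 = y" for n
    by (simp_all add: z_def)
  have nz: "norm (z n) \<le> norm y * (1/2) ^ n" for n
  proof (induction n)
    case (Suc n)
    then show ?case
      using res[of "z n"] by (simp add: z_Suc)
  qed (simp add: z_0)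
  have nX: "norm (X (z n)) \<le> k * norm y * (1/2) ^ n" for n
    using X[of "z n"] mult_left_mono[OF nz[of n] \<open>k \<ge> 0\<close>] by (simp add: mult.assoc)
  have geo: "(\<lambda>n. k * norm y * (1/2) ^ n) sums (2 * k * norm y)"
    using sums_mult[OF geometric_sums[of "1/2::real"], of "k * norm y"] by (simp add: mult_ac)
  have sX: "summable (\<lambda>n. norm (X (z n)))"
    by (rule summable_comparison_test'[OF sums_summable[OF geo], of 0]) (simp add: nX)
  define x where "x = (\<Sum>n. X (z n))"
  have "norm x \<le> (\<Sum>n. norm (X (z n)))"
    unfolding x_def by (rule summable_norm[OF sX])
  also have "\<dots> \<le> (\<Sum>n. k * norm y * (1/2) ^ n)"
    by (rule suminf_le[OF nX sX sums_summable[OF geo]])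
  also have "\<dots> = 2 * k * norm y"
    using geo by (simp add: sums_iff)
  finally have nx: "norm x \<le> 2 * k * norm y" .
  \<comment> \<open>Telescoping: up to the vanishing defect \<open>z n\<close>, the residual of each
    partial sum lies in \<open>M\<close>, and closedness of \<open>M\<close> carries this to the
    limit.\<close>
  have partial: "y - T (\<Sum>i<n. X (z i)) - z n = (\<Sum>i<n. m (z i))" for n
  proof (induction n)
    case (Suc n)
    then show ?case
      by (simp add: z_Suc blinfun.add_right algebra_simps)
  qed (simp add: z_0)
  have "(\<lambda>n. norm y * (1/2) ^ n) \<longlonglongrightarrow> norm y * 0"
    by (intro tendsto_intros LIMSEQ_power_zero) auto
  then have "z \<longlonglongrightarrow> 0"
    using nz by (intro Lim_null_comparison[of z "\<lambda>n. norm y * (1/2) ^ n"] always_eventually allI) auto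
  moreover have "(\<lambda>n. \<Sum>i<n. X (z i)) \<longlonglongrightarrow> x"
    unfolding x_def using summable_LIMSEQ[OF summable_norm_cancel[OF sX]] .
  ultimately have "(\<lambda>n. y - T (\<Sum>i<n. X (z i)) - z n) \<longlonglongrightarrow> y - T x - 0"
    by (intro tendsto_intros blinfun.tendsto)
  then have "(\<lambda>n. \<Sum>i<n. m (z i)) \<longlonglongrightarrow> y - T x"
    by (simp add: partial)
  then have "y - T x \<in> M"
    by (rule closed_sequentially[OF M(2), rotated]) (auto intro!: subspace_sum[OF M(1)] m)
  with nx show ?thesis
    by blast
qed

text \<open>The open mapping theorem for the map that \<open>T\<close> induces into the quotient by
  \<open>M\<close>, stated without forming the quotient. Baire's theorem yields approximate
  liftings, which the previous lemma makes exact modulo \<open>M\<close>.\<close>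

lemma open_mapping_mod_subspace:
  fixes T :: "'a::banach \<Rightarrow>\<^sub>L 'b::banach"
  assumes M: "subspace M" "closed M" and onto: "\<And>y. \<exists>x. y - T x \<in> M"
  obtains K where "K > 0" "\<And>y. \<exists>x. y - T x \<in> M \<and> norm x \<le> K * norm y"
proof -
  define P where "P n = {y. \<exists>x. norm x \<le> real n \<and> y - T x \<in> M}" for n :: nat
  have cover: "\<Union> (range (\<lambda>n. closure (P n))) = UNIV"
  proof (intro set_eqI iffI UNIV_I)
    fix y
    obtain x where x: "y - T x \<in> M"
      using onto by blast
    obtain n :: nat where "norm x \<le> real n"
      using real_arch_simple by blast
    with x have "y \<in> P n"
      by (auto simp: P_def)
    then show "y \<in> \<Union> (range (\<lambda>n. closure (P n)))"
      using closure_subset by blast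
  qed
  have "\<exists>n. interior (closure (P n)) \<noteq> {}"
  proof (rule ccontr)
    assume neg: "\<not> ?thesis"
    have "(euclidean :: 'b topology) interior_of \<Union> (range (\<lambda>n. closure (P n))) = {}"
      by (rule Baire_category_alt) (use neg in \<open>auto simp: completely_metrizable_space_euclidean\<close>)
    then show False
      by (simp only: cover) simp
  qed
  then obtain n y0 where "y0 \<in> interior (closure (P n))"
    by blast
  then obtain r where r: "r > 0" "ball y0 r \<subseteq> closure (P n)"
    by (meson mem_interior)
  \<comment> \<open>A lift below is \<open>c\<close> times a difference of two vectors of norm at
    most \<open>n\<close>, with \<open>c = 2 * norm y / r\<close>; \<open>n + 1\<close> in place of
    \<open>n\<close> keeps \<open>k\<close> positive.\<close>
  define k where "k = 4 * (real n + 1) / r"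
  have k: "k > 0"
    using r by (simp add: k_def)
  have approx: "\<exists>x. \<exists>m\<in>M. norm x \<le> k * norm y \<and> norm (y - T x - m) \<le> norm y / 2" for y
  proof (cases "y = 0")
    case True
    then show ?thesis
      by (intro exI[of _ 0] bexI[of _ 0]) (auto simp: subspace_0[OF M(1)])
  next
    case False
    \<comment> \<open>Scaling by \<open>1/c\<close> gives \<open>y\<close> the norm
      \<open>r / 2\<close>, so \<open>y0 + (1/c) *\<^sub>R y\<close> stays in the ball.
      Approximating it and \<open>y0\<close> within \<open>r / 8\<close> by points of
      \<open>P n\<close> and subtracting leaves an error of at most
      \<open>c * r / 4 = norm y / 2\<close>.\<close>
    define c where "c = 2 * norm y / r"
    have c: "c > 0"
      using False r by (simp add: c_def)
    have cn: "norm y / c = r / 2"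
      using False r by (simp add: c_def)
    have "y0 \<in> closure (P n)"
      using r by auto
    then obtain q where q: "q \<in> P n" "dist q y0 < r / 8"
      using r(1) unfolding closure_approachable by (meson divide_pos_pos zero_less_numeral)
    have "y0 + (1/c) *\<^sub>R y \<in> closure (P n)"
      using r cn c by (intro subsetD[OF r(2)]) (auto simp: dist_norm)
    then obtain p where p: "p \<in> P n" "dist p (y0 + (1/c) *\<^sub>R y) < r / 8"
      using r(1) unfolding closure_approachable by (meson divide_pos_pos zero_less_numeral)
    obtain xp xq where x: "norm xp \<le> real n" "p - T xp \<in> M" "norm xq \<le> real n" "q - T xq \<in> M"
      using p(1) q(1) by (auto simp: P_def)
    define x m where "x = c *\<^sub>R (xp - xq)" and "m = c *\<^sub>R ((p - T xp) - (q - T xq))"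
    have "norm (xp - xq) \<le> 2 * real n"
      using norm_triangle_ineq4[of xp xq] x by linarith
    then have "norm x \<le> c * (2 * (real n + 1))"
      using c by (simp add: x_def)
    also have "\<dots> = k * norm y"
      by (simp add: c_def k_def)
    finally have "norm x \<le> k * norm y" .
    moreover have "m \<in> M"
      unfolding m_def by (intro subspace_scale subspace_diff M x)
    moreover have "norm (y - T x - m) \<le> norm y / 2"
    proof -
      have "y - T x - m = c *\<^sub>R ((q - y0) - (p - (y0 + (1/c) *\<^sub>R y)))"
        using c by (simp add: x_def m_def blinfun.scaleR_right blinfun.diff_right algebra_simps)
      moreover have "norm ((q - y0) - (p - (y0 + (1/c) *\<^sub>R y))) \<le> r / 8 + r / 8"
        using norm_triangle_ineq4[of "q - y0" "p - (y0 + (1/c) *\<^sub>R y)"] p(2) q(2)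
        by (simp add: dist_norm)
      ultimately have "norm (y - T x - m) \<le> c * (r / 8 + r / 8)"
        using c by simp
      also have "\<dots> = norm y / 2"
        using r by (simp add: c_def)
      finally show ?thesis .
    qed
    ultimately show ?thesis
      by blast
  qed
  show thesis
    using that[of "2 * k"] k lifting_of_approximate_lifting[OF M _ approx] by simp
qed

lemma subspace_range_blinfun: "subspace (range (blinfun_apply T))"
  by (simp add: linear_subspace_image bounded_linear.linear blinfun.bounded_linear_right)

lemma span_range_blinfun_eq_UNIV_iff:
  "span (range (blinfun_apply T) \<union> C) = UNIV \<longleftrightarrow> (\<forall>y. \<exists>x. y - blinfun_apply T x \<in> span C)"
proof -
  have "span (range (blinfun_apply T) \<union> C) = {blinfun_apply T x + c | x c. c \<in> span C}"
    unfolding span_Un span_eq_iff[THEN iffD2, OF subspace_range_blinfun] by auto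
  moreover have "y \<in> {blinfun_apply T x + c | x c. c \<in> span C} \<longleftrightarrow> (\<exists>x. y - blinfun_apply T x \<in> span C)" for y
    by (simp, metis add_diff_cancel_left' add_diff_cancel_right' diff_add_cancel add.commute)
  ultimately show ?thesis
    by blast
qed

text \<open>Once \<open>C\<close> is thinned to \<open>D\<close> with \<open>span D\<close> meeting
  the range only in 0, a lift modulo \<open>span D\<close> of a vector in the range is an exact
  preimage. The bound on \<open>x\<close> replaces an estimate in the quotient by the
  kernel.\<close>

lemma finite_cokernel_bounded_lifting:
  fixes T :: "'a::banach \<Rightarrow>\<^sub>L 'b::banach"
  assumes "finite C" "span (range (blinfun_apply T) \<union> C) = UNIV"
  obtains K where "K > 0" "\<And>x'. \<exists>x. T x = T x' \<and> norm x \<le> K * norm (T x')"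
    and "closed (range (blinfun_apply T))"
proof -
  obtain D where D: "D \<subseteq> C" "span (range (blinfun_apply T) \<union> D) = UNIV"
    and trivial: "range (blinfun_apply T) \<inter> span D = {0}"
    using finite_complement_of_subspace[OF subspace_range_blinfun[of T] assms(1)] assms(2) by metis
  have zero: "T x = 0" if "T x \<in> span D" for x
    using trivial that by blast
  have "closed (span D)"
    using finite_subset[OF D(1) assms(1)] by (rule closed_span_finite)
  moreover have onto: "\<exists>x. y - T x \<in> span D" for y
    using D(2) span_range_blinfun_eq_UNIV_iff by blast
  ultimately obtain K where K: "K > 0" "\<And>y. \<exists>x. y - T x \<in> span D \<and> norm x \<le> K * norm y"
    using open_mapping_mod_subspace[OF subspace_span] by metis
  have "\<exists>x. T x = T x' \<and> norm x \<le> K * norm (T x')" for x'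
  proof -
    obtain x where x: "T x' - T x \<in> span D" "norm x \<le> K * norm (T x')"
      using K(2) by blast
    have "T (x' - x) = 0"
      using x(1) by (intro zero) (simp add: blinfun.diff_right)
    then show ?thesis
      using x(2) by (auto simp: blinfun.diff_right)
  qed
  moreover have "closed (range (blinfun_apply T))"
    unfolding closed_sequential_limits
  proof (intro allI impI, elim conjE)
    fix s l assume s: "\<forall>n. s n \<in> range (blinfun_apply T)" and lim: "s \<longlonglongrightarrow> l"
    have "\<forall>n. \<exists>x. s n = T x"
      using s by (auto simp: image_iff)
    then obtain w where w: "\<And>n. s n = T (w n)"
      by metis
    obtain x where x: "l - T x \<in> span D"
      using onto by blast
    have "\<forall>n. \<exists>x. s n - l - T x \<in> span D \<and> norm x \<le> K * norm (s n - l)"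
      using K(2) by blast
    then obtain h where h: "\<And>n. s n - l - T (h n) \<in> span D" "\<And>n. norm (h n) \<le> K * norm (s n - l)"
      by metis
    \<comment> \<open>The difference of the two sides lies in the range and in
      \<open>span D\<close>, hence vanishes; since \<open>h\<close> tends to 0, the limit of
      \<open>s\<close> is \<open>T x\<close>.\<close>
    have "s = (\<lambda>n. T (h n) + T x)"
    proof
      fix n
      have "(s n - l - T (h n)) + (l - T x) \<in> span D"
        by (intro span_add h x)
      then have "T (w n - h n - x) \<in> span D"
        by (simp add: blinfun.diff_right w)
      then have "T (w n - h n - x) = 0"
        by (rule zero)
      then show "s n = T (h n) + T x"
        by (simp add: blinfun.diff_right w diff_eq_eq add.commute)
    qed
    moreover have "(\<lambda>n. K * norm (s n - l)) \<longlonglongrightarrow> K * norm (l - l)"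
      by (intro tendsto_intros lim)
    then have "h \<longlonglongrightarrow> 0"
      using h(2) by (intro Lim_null_comparison[of h "\<lambda>n. K * norm (s n - l)"] always_eventually allI) auto
    then have "(\<lambda>n. T (h n) + T x) \<longlonglongrightarrow> T 0 + T x"
      by (intro tendsto_intros blinfun.tendsto)
    ultimately have "s \<longlonglongrightarrow> T x"
      by simp
    then show "l \<in> range (blinfun_apply T)"
      using LIMSEQ_unique[OF lim] by blast
  qed
  ultimately show thesis
    using that K(1) by blast
qed

section \<open>Openness of the Fredholm condition\<close>

text \<open>Each condition \<open>u \<bullet> b = 0\<close> costs at most one dimension, so
  \<open>V\<close> is spanned by finitely many vectors together with its part orthogonal to
  \<open>B\<close>.\<close>

lemma finite_dim_of_trivial_orthogonal_part:
  fixes V B :: "'a::real_inner set"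
  assumes "subspace V" "finite B" "\<And>u. u \<in> V \<Longrightarrow> (\<And>b. b \<in> B \<Longrightarrow> u \<bullet> b = 0) \<Longrightarrow> u = 0"
  shows "\<exists>D. finite D \<and> span D = V"
proof -
  have "\<exists>D\<subseteq>V. finite D \<and> V \<subseteq> span (D \<union> {u\<in>V. \<forall>b\<in>B. u \<bullet> b = 0})"
    using assms(2)
  proof (induction B rule: finite_induct)
    case empty
    have "V \<subseteq> span V"
      by (rule span_superset)
    then show ?case
      by (intro exI[of _ "{}"]) simp
  next
    case (insert b B)
    let ?V = "{u\<in>V. \<forall>b\<in>B. u \<bullet> b = 0}" and ?V' = "{u\<in>V. \<forall>b\<in>insert b B. u \<bullet> b = 0}"
    from insert.IH obtain D where D: "D \<subseteq> V" "finite D" "V \<subseteq> span (D \<union> ?V)"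
      by (elim exE conjE)
    have "\<exists>d\<in>V. ?V \<subseteq> span (insert d (D \<union> ?V'))"
    proof (cases "\<exists>d\<in>?V. d \<bullet> b \<noteq> 0")
      case True
      then obtain d where d: "d \<in> ?V" "d \<bullet> b \<noteq> 0"
        by blast
      have "u \<in> span (insert d (D \<union> ?V'))" if u: "u \<in> ?V" for u
      proof -
        define c where "c = (u \<bullet> b) / (d \<bullet> b)"
        have "u - c *\<^sub>R d \<in> V"
          using u d(1) by (intro subspace_diff subspace_scale assms(1)) auto
        then have "u - c *\<^sub>R d \<in> ?V'"
          using u d by (auto simp: inner_diff_left c_def)
        then have "u - c *\<^sub>R d \<in> span (D \<union> ?V')"
          by (intro span_base) blast
        then show ?thesis
          unfolding span_breakdown_eq by blast
      qed
      then show ?thesis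
        using d(1) by blast
    next
      \<comment> \<open>Here \<open>b\<close> imposes no new condition, and 0 serves as the added
        vector \<open>d\<close>.\<close>
      case False
      then have "?V \<subseteq> ?V'"
        by blast
      then have "?V \<subseteq> span (insert 0 (D \<union> ?V'))"
        by (meson Un_upper2 order_trans span_superset subset_insertI)
      then show ?thesis
        using subspace_0[OF assms(1)] by blast
    qed
    then obtain d where d: "d \<in> V" "?V \<subseteq> span (insert d D \<union> ?V')"
      by auto
    have "D \<subseteq> span (insert d D \<union> ?V')"
      by (auto intro: span_base)
    with d(2) have "span (D \<union> ?V) \<subseteq> span (insert d D \<union> ?V')"
      by (intro span_minimal subspace_span) blast
    then show ?case
      using D d(1) by (intro exI[of _ "insert d D"]) auto
  qed
  then obtain D where D: "D \<subseteq> V" "finite D" "V \<subseteq> span (D \<union> {u\<in>V. \<forall>b\<in>B. u \<bullet> b = 0})"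
    by (elim exE conjE)
  have "{u\<in>V. \<forall>b\<in>B. u \<bullet> b = 0} \<subseteq> {0}"
    using assms(3) by blast
  then have "D \<union> {u\<in>V. \<forall>b\<in>B. u \<bullet> b = 0} \<subseteq> insert 0 D"
    by blast
  then have "V \<subseteq> span (insert 0 D)"
    using D(3) span_mono by blast
  then have "V \<subseteq> span D"
    by simp
  moreover have "span D \<subseteq> V"
    using D(1) assms(1) by (rule span_minimal)
  ultimately show ?thesis
    using D(2) by blast
qed

lemma subspace_blinfun_kernel: "subspace (blinfun_kernel T)"
  by (auto simp: subspace_def blinfun_kernel_def blinfun.add_right blinfun.scaleR_right)

text \<open>For the kernel, the lifting constant \<open>K\<close> shows that a vector of the kernel
  of \<open>S\<close> orthogonal to that of \<open>T\<close> is zero. For the cokernel, the constant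
  \<open>L\<close> makes lifts for \<open>T\<close> approximate lifts for \<open>S\<close> with the
  same \<open>C\<close>. The radius limits both errors to one half.\<close>

lemma fredholm_perturbation:
  fixes T :: "'a::{real_inner,banach} \<Rightarrow>\<^sub>L 'b::banach"
  assumes "fredholm T"
  obtains r where "r > 0" "\<And>S. norm (S - T) < r \<Longrightarrow> fredholm S"
proof -
  obtain B C where B: "finite B" "span B = blinfun_kernel T"
    and C: "finite C" "span (range (blinfun_apply T) \<union> C) = UNIV"
    using assms unfolding fredholm_def by blast
  obtain K where K: "K > 0" "\<And>x'. \<exists>x. T x = T x' \<and> norm x \<le> K * norm (T x')"
    using finite_cokernel_bounded_lifting[OF C] by blast
  obtain L where L: "L > 0" "\<And>y. \<exists>x. y - T x \<in> span C \<and> norm x \<le> L * norm y"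
    using open_mapping_mod_subspace[OF subspace_span closed_span_finite[OF C(1)]]
      C(2) span_range_blinfun_eq_UNIV_iff by metis
  define r where "r = min (1 / (2 * K)) (1 / (2 * L))"
  have "fredholm S" if S: "norm (S - T) < r" for S
  proof -
    have SK: "norm (S - T) * K \<le> 1 / 2" and SL: "norm (S - T) * L \<le> 1 / 2"
      using S K(1) L(1) by (auto simp: r_def field_simps)
    have "\<exists>D. finite D \<and> span D = blinfun_kernel S"
    proof (rule finite_dim_of_trivial_orthogonal_part[OF subspace_blinfun_kernel B(1)])
      \<comment> \<open>Every \<open>u\<close> in the kernel of \<open>S\<close> is within \<open>norm u / 2\<close> of the kernel of \<open>T\<close>.\<close>
      fix u assume u: "u \<in> blinfun_kernel S" and orth: "\<And>b. b \<in> B \<Longrightarrow> u \<bullet> b = 0"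
      have orth_ker: "u \<bullet> v = 0" if "v \<in> blinfun_kernel T" for v
        using that orth unfolding B(2)[symmetric]
        by (metis orthogonal_def orthogonal_to_span)
      obtain x where x: "T x = T u" "norm x \<le> K * norm (T u)"
        using K(2) by blast
      have "T u = - ((S - T) u)"
        using u by (simp add: blinfun_kernel_def blinfun.diff_left)
      then have "norm (T u) \<le> norm (S - T) * norm u"
        by (metis norm_blinfun norm_minus_cancel)
      then have "norm x \<le> K * (norm (S - T) * norm u)"
        using x(2) K(1) by (meson mult_left_mono order_trans less_imp_le)
      also have "\<dots> = (norm (S - T) * K) * norm u"
        by simp
      also have "\<dots> \<le> 1 / 2 * norm u"
        by (rule mult_right_mono[OF SK]) simp
      finally have nx: "norm x \<le> norm u / 2"
        by simp
      \<comment> \<open>\<open>u - x\<close> lies in the kernel of \<open>T\<close>, so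
        \<open>u \<bullet> u = u \<bullet> x\<close>, which is at most half of
        \<open>u \<bullet> u\<close>.\<close>
      have "u \<bullet> (u - x) = 0"
        using x(1) by (intro orth_ker) (simp add: blinfun_kernel_def blinfun.diff_right)
      then have "norm u * norm u = u \<bullet> x"
        by (simp add: inner_diff_right dot_square_norm power2_eq_square)
      also have "\<dots> \<le> norm u * norm x"
        by (rule norm_cauchy_schwarz)
      also have "\<dots> \<le> norm u * (norm u / 2)"
        by (rule mult_left_mono[OF nx]) simp
      finally have "norm u * norm u \<le> 0"
        by simp
      then show "u = 0"
        by (simp add: mult_le_0_iff)
    qed
    moreover have fin: "span (range (blinfun_apply S) \<union> C) = UNIV"
      unfolding span_range_blinfun_eq_UNIV_iff
    proof
      fix y
      \<comment> \<open>With \<open>x\<close> a lift of \<open>z\<close> for \<open>T\<close> and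
        \<open>m = z - T x\<close>, the defect is \<open>(T - S) x\<close>.\<close>
      have "\<exists>x. \<exists>m\<in>span C. norm x \<le> L * norm z \<and> norm (z - S x - m) \<le> norm z / 2" for z
      proof -
        obtain x where x: "z - T x \<in> span C" "norm x \<le> L * norm z"
          using L(2) by blast
        have "norm (z - S x - (z - T x)) = norm ((S - T) x)"
          by (simp add: blinfun.diff_left norm_minus_commute)
        also have "\<dots> \<le> norm (S - T) * (L * norm z)"
          using x(2) by (meson mult_left_mono norm_blinfun norm_ge_zero order_trans)
        also have "\<dots> = (norm (S - T) * L) * norm z"
          by simp
        also have "\<dots> \<le> 1 / 2 * norm z"
          by (rule mult_right_mono[OF SL]) simp
        finally have "norm (z - S x - (z - T x)) \<le> norm z / 2"
          by simp
        then show ?thesis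
          using x by blast
      qed
      then show "\<exists>x. y - S x \<in> span C"
        using lifting_of_approximate_lifting[OF subspace_span closed_span_finite[OF C(1)], of L S y] L(1)
        by auto
    qed
    moreover have "closed (range (blinfun_apply S))"
      using finite_cokernel_bounded_lifting[OF C(1) fin] by blast
    ultimately show ?thesis
      unfolding fredholm_def using C(1) by blast
  qed
  moreover have "r > 0"
    using K(1) L(1) by (simp add: r_def)
  ultimately show thesis
    using that by blast
qed

section \<open>Null sets\<close>

text \<open>Sard's lemma in dimension one: the problem is moved to \<open>real^1\<close>, where the
  zero matrix has deficient rank, and back by the Lipschitz coordinate map.\<close>

lemma negligible_image_zero_derivative:
  fixes f :: "real \<Rightarrow> real"
  assumes "\<And>t. t \<in> E \<Longrightarrow> (f has_derivative (\<lambda>_. 0)) (at t within E)"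
  shows "negligible (f ` E)"
proof -
  let ?g = "\<lambda>x::real^1. vec (f (x $ 1)) :: real^1" and ?E = "vec ` E :: (real^1) set"
  have der: "(?g has_derivative (\<lambda>_. 0)) (at x within ?E)" if x: "x \<in> ?E" for x
  proof -
    obtain t where t: "t \<in> E" "x = vec t"
      using x by blast
    have "(f has_derivative (\<lambda>x. x * 0)) (at t within E)"
      using assms[OF t(1)] by simp
    moreover have "(*\<^sub>R) 0 = (\<lambda>_::real^1. 0 :: real^1)"
      by (simp add: fun_eq_iff)
    ultimately show ?thesis
      using has_derivative_vector_1[of f "\<lambda>_. 0" t E] by (simp add: t(2))
  qed
  have "matrix (\<lambda>_::real^1. 0 :: real^1) = 0"
    by (simp add: matrix_def vec_eq_iff)
  with der have "negligible (?g ` ?E)"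
    by (intro baby_Sard[where f' = "\<lambda>_ _. 0"]) auto
  then have "negligible ((\<lambda>x::real^1. x $ 1) ` (?g ` ?E))"
  proof (rule negligible_locally_Lipschitz_image[rotated])
    fix x :: "real^1" assume "x \<in> ?g ` ?E"
    show "\<exists>T B. open T \<and> x \<in> T \<and> (\<forall>y\<in>(?g ` ?E) \<inter> T. norm (y $ 1 - x $ 1) \<le> B * norm (y - x))"
      by (intro exI[of _ UNIV] exI[of _ 1]) (auto simp flip: vector_minus_component intro: component_le_norm_cart)
  qed simp
  also have "(\<lambda>x::real^1. x $ 1) ` (?g ` ?E) = f ` E"
    by (auto simp: image_image)
  finally show ?thesis .
qed

text \<open>By hypothesis, chords of \<open>G\<close> ending at a fixed point of \<open>G\<close>
  become horizontal. On countably many pieces that are graphs this says that the derivative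
  vanishes.\<close>

lemma negligible_snd_image_horizontal:
  fixes G :: "(real \<times> real) set"
  assumes horizontal: "\<And>p e. p \<in> G \<Longrightarrow> e > 0 \<Longrightarrow>
    \<exists>r>0. \<forall>q\<in>G. dist q p < r \<longrightarrow> \<bar>snd q - snd p\<bar> \<le> e * \<bar>fst q - fst p\<bar>"
  shows "negligible (snd ` G)"
proof -
  obtain D :: "(real \<times> real) set" where D: "countable D" "\<And>X. open X \<Longrightarrow> X \<noteq> {} \<Longrightarrow> \<exists>d\<in>D. d \<in> X"
    using countable_dense_exists by blast
  \<comment> \<open>On each piece \<open>P n c\<close> the slope bound for \<open>e = 1\<close> holds at a uniform scale, so \<open>P n c\<close> is the
    graph of a Lipschitz function of the first coordinate.\<close>
  define P where "P n c = {p \<in> G \<inter> ball c (inverse (real (Suc n)) / 2).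
      \<forall>q\<in>G. dist q p < inverse (real (Suc n)) \<longrightarrow> \<bar>snd q - snd p\<bar> \<le> \<bar>fst q - fst p\<bar>}" for n c
  have lip: "\<bar>snd q - snd p\<bar> \<le> \<bar>fst q - fst p\<bar>" if "p \<in> P n c" "q \<in> P n c" for p q n c
  proof -
    \<comment> \<open>The halved radius of the balls in \<open>P\<close> is what brings any two
      points of a piece this close.\<close>
    have "dist q p < inverse (real (Suc n))"
      using that dist_triangle2[of q p c] by (auto simp: P_def dist_commute)
    then show ?thesis
      using that by (auto simp: P_def)
  qed
  have "negligible (snd ` P n c)" for n c
  proof -
    define f where "f t = snd (inv_into (P n c) fst t)" for t
    have inj: "inj_on fst (P n c)"
      using lip[of _ n c] by (fastforce intro!: inj_onI prod_eqI)
    have f: "f (fst p) = snd p" if "p \<in> P n c" for p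
      using that by (simp add: f_def inv_into_f_f[OF inj])
    have "(f has_derivative (\<lambda>_. 0)) (at t within fst ` P n c)" if t: "t \<in> fst ` P n c" for t
      unfolding has_derivative_within_alt
    proof (intro conjI allI impI)
      fix e :: real assume "e > 0"
      obtain p where p: "p \<in> P n c" "t = fst p"
        using t by blast
      then have "p \<in> G"
        by (simp add: P_def)
      then obtain r where r: "r > 0"
        "\<And>q. q \<in> G \<Longrightarrow> dist q p < r \<Longrightarrow> \<bar>snd q - snd p\<bar> \<le> e * \<bar>fst q - fst p\<bar>"
        using horizontal \<open>e > 0\<close> by blast
      \<comment> \<open>The Lipschitz bound turns closeness of first coordinates into closeness in
        the plane, at the cost of the factor 2 in \<open>r / 2\<close>.\<close>
      have "norm (f s - f t - 0) \<le> e * norm (s - t)"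
        if s: "s \<in> fst ` P n c" "norm (s - t) < r / 2" for s
      proof -
        obtain q where q: "q \<in> P n c" "s = fst q"
          using s(1) by blast
        have "dist q p \<le> \<bar>fst q - fst p\<bar> + \<bar>snd q - snd p\<bar>"
          using sqrt_sum_squares_le_sum_abs[of "fst q - fst p" "snd q - snd p"]
          by (simp add: dist_prod_def dist_real_def)
        also have "\<dots> < r"
          using lip[OF p(1) q(1)] s(2) p(2) q(2) by simp
        finally show ?thesis
          using r(2)[of q] q p f by (simp add: P_def)
      qed
      then show "\<exists>d>0. \<forall>s\<in>fst ` P n c. norm (s - t) < d \<longrightarrow> norm (f s - f t - 0) \<le> e * norm (s - t)"
        using r(1) by (intro exI[of _ "r / 2"]) auto
    qed simp
    then have "negligible (f ` fst ` P n c)"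
      by (rule negligible_image_zero_derivative)
    also have "f ` fst ` P n c = snd ` P n c"
      using f by (auto simp: image_image)
    finally show ?thesis .
  qed
  then have "negligible (\<Union>((\<lambda>(n, c). snd ` P n c) ` (UNIV \<times> D)))"
    using D(1) by (intro negligible_countable_Union) auto
  moreover have "snd ` G \<subseteq> \<Union>((\<lambda>(n, c). snd ` P n c) ` (UNIV \<times> D))"
  proof (rule image_subsetI)
    fix p assume p: "p \<in> G"
    then obtain r where r: "r > 0" "\<And>q. q \<in> G \<Longrightarrow> dist q p < r \<Longrightarrow> \<bar>snd q - snd p\<bar> \<le> 1 * \<bar>fst q - fst p\<bar>"
      using horizontal[of p 1] by auto
    obtain n where n: "inverse (real (Suc n)) < r"
      using reals_Archimedean[OF r(1)] by blast
    obtain c where c: "c \<in> D" "c \<in> ball p (inverse (real (Suc n)) / 2)"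
      using D(2)[of "ball p (inverse (real (Suc n)) / 2)"] by auto
    have "p \<in> P n c"
      using p c r(2) n by (auto simp: P_def dist_commute)
    then show "snd p \<in> \<Union>((\<lambda>(n, c). snd ` P n c) ` (UNIV \<times> D))"
      using c(1) by blast
  qed
  ultimately show ?thesis
    by (rule negligible_subset)
qed

section \<open>Crossings\<close>

lemma mem_adjoint_graph_op_graph_iff:
  "(v, z) \<in> adjoint_graph (op_graph j T) \<longleftrightarrow> (\<forall>u. T u \<bullet> v = j u \<bullet> z)"
  by (force simp: adjoint_graph_def op_graph_def)

text \<open>The shear \<open>(v, z) \<mapsto> (v, z - \<delta> *\<^sub>R v)\<close> carries both the
  graph and the adjoint graph of the shifted operator to those of \<open>T\<close>.\<close>

lemma selfadjoint_op_shift: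
  assumes "selfadjoint_op j T"
  shows "selfadjoint_op j (T + \<delta> *\<^sub>R j)"
proof -
  have "(v, z) \<in> adjoint_graph (op_graph j (T + \<delta> *\<^sub>R j)) \<longleftrightarrow> (v, z - \<delta> *\<^sub>R v) \<in> adjoint_graph (op_graph j T)" for v z
    by (simp add: mem_adjoint_graph_op_graph_iff blinfun.add_left blinfun.scaleR_left
        inner_add_left inner_diff_right eq_diff_eq)
  moreover have "(v, z) \<in> op_graph j (T + \<delta> *\<^sub>R j) \<longleftrightarrow> (v, z - \<delta> *\<^sub>R v) \<in> op_graph j T" for v z
    by (auto simp: op_graph_def blinfun.add_left blinfun.scaleR_left algebra_simps)
  ultimately show ?thesis
    using assms unfolding selfadjoint_op_def by auto
qed

lemma selfadjoint_op_kernel_orthogonal: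
  assumes "selfadjoint_op j T" "T u = 0"
  shows "T v \<bullet> j u = 0"
proof -
  have "(j u, T u) \<in> adjoint_graph (op_graph j T)"
    using assms(1) by (auto simp: selfadjoint_op_def op_graph_def)
  then show ?thesis
    using assms(2) by (simp add: mem_adjoint_graph_op_graph_iff)
qed

text \<open>Subtracting small preimages \<open>x n\<close> of \<open>T (u n)\<close> moves
  \<open>u n\<close> into the finite-dimensional kernel, where bounded sequences have convergent
  subsequences.\<close>

lemma fredholm_almost_kernel_subsequence:
  fixes T :: "'a::banach \<Rightarrow>\<^sub>L 'b::banach"
  assumes "fredholm T" "\<And>n. norm (u n) \<le> M" "(\<lambda>n. T (u n)) \<longlonglongrightarrow> 0"
  obtains l r where "T l = 0" "strict_mono r" "(u \<circ> r) \<longlonglongrightarrow> l"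
proof -
  obtain B C where B: "finite B" "span B = blinfun_kernel T"
    and C: "finite C" "span (range (blinfun_apply T) \<union> C) = UNIV"
    using assms(1) unfolding fredholm_def by blast
  obtain K where K: "K > 0" "\<And>x'. \<exists>x. T x = T x' \<and> norm x \<le> K * norm (T x')"
    using finite_cokernel_bounded_lifting[OF C] by blast
  have "\<forall>n. \<exists>x. T x = T (u n) \<and> norm x \<le> K * norm (T (u n))"
    using K(2) by blast
  then obtain x where x: "\<And>n. T (x n) = T (u n)" "\<And>n. norm (x n) \<le> K * norm (T (u n))"
    by metis
  have "(\<lambda>n. K * norm (T (u n))) \<longlonglongrightarrow> K * norm (0 :: 'b)"
    by (intro tendsto_intros assms(3))
  then have x0: "x \<longlonglongrightarrow> 0"
    using x(2) by (intro Lim_null_comparison[of x "\<lambda>n. K * norm (T (u n))"] always_eventually allI) auto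
  then obtain X where X: "\<And>n. norm (x n) \<le> X"
    by (metis Bseq_def convergentI convergent_imp_Bseq)
  have "u n - x n \<in> span B" for n
    using x(1) unfolding B(2) by (simp add: blinfun_kernel_def blinfun.diff_right)
  moreover have "norm (u n - x n) \<le> M + X" for n
    using norm_triangle_ineq4[of "u n" "x n"] assms(2)[of n] X[of n] by linarith
  ultimately obtain l r where l: "l \<in> span B" "strict_mono r" "((\<lambda>n. u n - x n) \<circ> r) \<longlonglongrightarrow> l"
    using span_finite_sequentially_compact[OF B(1), of "\<lambda>n. u n - x n" "M + X"] by blast
  have "(\<lambda>n. ((\<lambda>n. u n - x n) \<circ> r) n + (x \<circ> r) n) \<longlonglongrightarrow> l + 0"
    by (intro tendsto_add l LIMSEQ_subseq_LIMSEQ[OF x0 l(2)])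
  then have "(u \<circ> r) \<longlonglongrightarrow> l"
    by (simp add: o_def)
  moreover have "T l = 0"
    using l(1) unfolding B(2) by (simp add: blinfun_kernel_def)
  ultimately show thesis
    using that l(2) by blast
qed

text \<open>Isotropic kernel vectors, rather than vectors of the radical, give a condition on a
  single vector that passes to limits.\<close>

definition isotropic_crossings ::
  "('w::real_inner \<Rightarrow>\<^sub>L 'h::real_inner) \<Rightarrow> (real \<Rightarrow> 'w \<Rightarrow>\<^sub>L 'h) \<Rightarrow> (real \<Rightarrow> 'w \<Rightarrow>\<^sub>L 'h) \<Rightarrow> (real \<times> real) set" where
  "isotropic_crossings j A A' =
     {(t, \<delta>). t \<in> {0..1} \<and> (\<exists>u. u \<noteq> 0 \<and> (A t + \<delta> *\<^sub>R j) u = 0 \<and> A' t u \<bullet> j u = 0)}"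

lemma isotropic_crossings_horizontal:
  fixes j :: "'w::{real_inner,banach} \<Rightarrow>\<^sub>L 'h::{real_inner,banach}"
  assumes inj: "inj (blinfun_apply j)"
    and t: "t \<in> {0..1}"
    and der: "(A has_vector_derivative A' t) (at t within {0..1})"
    and cont: "continuous_on {0..1} A'"
    and sa: "selfadjoint_op j (A t + \<delta> *\<^sub>R j)" and fr: "fredholm (A t + \<delta> *\<^sub>R j)"
    and e: "e > 0"
  shows "\<exists>r>0. \<forall>q\<in>isotropic_crossings j A A'. dist q (t, \<delta>) < r \<longrightarrow> \<bar>snd q - \<delta>\<bar> \<le> e * \<bar>fst q - t\<bar>"
proof (rule ccontr)
  define T where "T = A t + \<delta> *\<^sub>R j"
  assume neg: "\<not> ?thesis"
  \<comment> \<open>Failure of the claim at every scale \<open>1 / (n + 1)\<close> yields points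
    with slope above \<open>e\<close>; unit kernel vectors keep the later limit \<open>l\<close>
    nonzero.\<close>
  have "\<exists>s d u. s \<in> {0..1} \<and> dist (s, d) (t, \<delta>) < inverse (real (Suc n)) \<and> e * \<bar>s - t\<bar> < \<bar>d - \<delta>\<bar> \<and>
      norm u = 1 \<and> (A s + d *\<^sub>R j) u = 0 \<and> A' s u \<bullet> j u = 0" for n
  proof -
    have "inverse (real (Suc n)) > 0"
      by simp
    with neg obtain q where q: "q \<in> isotropic_crossings j A A'" "dist q (t, \<delta>) < inverse (real (Suc n))"
      "\<not> \<bar>snd q - \<delta>\<bar> \<le> e * \<bar>fst q - t\<bar>"
      by blast
    obtain s d where sd: "q = (s, d)"
      by (cases q)
    obtain u where u: "u \<noteq> 0" "(A s + d *\<^sub>R j) u = 0" "A' s u \<bullet> j u = 0" and s: "s \<in> {0..1}"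
      using q(1) unfolding sd isotropic_crossings_def by blast
    define v where "v = u /\<^sub>R norm u"
    have "norm v = 1" "(A s + d *\<^sub>R j) v = 0" "A' s v \<bullet> j v = 0"
      using u by (simp_all add: v_def blinfun.scaleR_right)
    then show ?thesis
      using s q(2,3) unfolding sd by (intro exI[of _ s] exI[of _ d] exI[of _ v]) auto
  qed
  then obtain s d u where s: "\<And>n. s n \<in> {0..1}"
    and near: "\<And>n. dist (s n, d n) (t, \<delta>) < inverse (real (Suc n))"
    and steep: "\<And>n. e * \<bar>s n - t\<bar> < \<bar>d n - \<delta>\<bar>"
    and nu: "\<And>n. norm (u n) = 1"
    and ker: "\<And>n. (A (s n) + d n *\<^sub>R j) (u n) = 0"
    and iso: "\<And>n. A' (s n) (u n) \<bullet> j (u n) = 0"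
    by metis
  have "(\<lambda>n. dist (s n, d n) (t, \<delta>)) \<longlonglongrightarrow> 0"
    by (rule Lim_null_comparison[OF _ LIMSEQ_inverse_real_of_nat])
      (use near in \<open>auto intro!: always_eventually less_imp_le\<close>)
  then have sd_lim: "(\<lambda>n. (s n, d n)) \<longlonglongrightarrow> (t, \<delta>)"
    by (subst tendsto_dist_iff)
  have s_lim: "s \<longlonglongrightarrow> t" and d_lim: "d \<longlonglongrightarrow> \<delta>"
    using tendsto_fst[OF sd_lim] tendsto_snd[OF sd_lim] by simp_all
  have A_lim: "(\<lambda>n. A (s n)) \<longlonglongrightarrow> A t"
    using continuous_within_tendsto_compose[OF has_vector_derivative_continuous[OF der] _ s_lim] s by simp
  have A'_lim: "(\<lambda>n. A' (s n)) \<longlonglongrightarrow> A' t"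
    using continuous_on_tendsto_compose[OF cont s_lim t] s by simp
  have "(\<lambda>n. norm (T - (A (s n) + d n *\<^sub>R j))) \<longlonglongrightarrow> norm (T - (A t + \<delta> *\<^sub>R j))"
    by (intro tendsto_intros A_lim d_lim)
  then have "(\<lambda>n. norm (T - (A (s n) + d n *\<^sub>R j))) \<longlonglongrightarrow> 0"
    by (simp add: T_def)
  moreover have "norm (T (u n)) \<le> norm (T - (A (s n) + d n *\<^sub>R j))" for n
    using norm_blinfun[of "T - (A (s n) + d n *\<^sub>R j)" "u n"] ker[of n] nu[of n]
    by (simp add: blinfun.diff_left)
  ultimately have "(\<lambda>n. T (u n)) \<longlonglongrightarrow> 0"
    by (intro Lim_null_comparison[of "\<lambda>n. T (u n)" "\<lambda>n. norm (T - (A (s n) + d n *\<^sub>R j))"] always_eventually allI)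
  moreover have "fredholm T"
    using fr by (simp add: T_def)
  ultimately obtain l r where l: "T l = 0" "strict_mono r" "(u \<circ> r) \<longlonglongrightarrow> l"
    using fredholm_almost_kernel_subsequence[of T u 1] nu by auto
  have u_lim: "(\<lambda>n. u (r n)) \<longlonglongrightarrow> l"
    using l(3) by (simp add: o_def)
  have "norm l = 1"
    using tendsto_norm[OF u_lim] by (simp add: nu LIMSEQ_const_iff)
  then have "j l \<noteq> 0"
    using inj by (metis blinfun.zero_right injD norm_zero zero_neq_one)
  define c where "c = j l \<bullet> j l"
  have c: "c > 0"
    using \<open>j l \<noteq> 0\<close> by (simp add: c_def)
  have j_lim: "(\<lambda>n. j (u (r n)) \<bullet> j l) \<longlonglongrightarrow> c"
    unfolding c_def by (intro tendsto_intros blinfun.tendsto u_lim)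
  have "(\<lambda>n. A' (s (r n)) (u (r n)) \<bullet> j (u (r n))) \<longlonglongrightarrow> A' t l \<bullet> j l"
    using LIMSEQ_subseq_LIMSEQ[OF A'_lim l(2)]
    by (intro tendsto_intros blinfun.tendsto u_lim) (simp add: o_def)
  then have "A' t l \<bullet> j l = 0"
    by (simp add: iso LIMSEQ_const_iff)
  then have A'_lim0: "(\<lambda>n. A' t (u (r n)) \<bullet> j l) \<longlonglongrightarrow> 0"
    using tendsto_inner[OF blinfun.tendsto[OF tendsto_const u_lim] tendsto_const, of "A' t" "j l"] by simp
  define m where "m = norm (j l) + 1"
  have m: "m > 0" "norm (j l) \<le> m"
    unfolding m_def by (auto intro: add_nonneg_pos)
  \<comment> \<open>The remainder and the derivative term will each contribute at most
    \<open>e * c / 8\<close> per unit of \<open>\<bar>s - t\<bar>\<close>. Their sum forces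
    \<open>j v \<bullet> j l \<le> c / 4\<close>, against the eventual lower bound
    \<open>c / 2\<close>.\<close>
  define \<eta> where "\<eta> = e * c / (8 * m)"
  have \<eta>: "\<eta> > 0"
    using e c m by (simp add: \<eta>_def)
  have \<eta>_jl: "\<eta> * norm (j l) \<le> e * c / 8"
    using mult_left_mono[OF m(2) less_imp_le[OF \<eta>]] m(1) by (simp add: \<eta>_def)
  obtain \<rho> where \<rho>: "\<rho> > 0"
    "\<And>x. x \<in> {0..1} \<Longrightarrow> norm (x - t) < \<rho> \<Longrightarrow> norm (A x - A t - (x - t) *\<^sub>R A' t) \<le> \<eta> * norm (x - t)"
    using der \<eta> unfolding has_vector_derivative_def has_derivative_within_alt by blast
  have "\<forall>\<^sub>F n in sequentially. norm (s (r n) - t) < \<rho>"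
    using LIMSEQ_subseq_LIMSEQ[OF s_lim l(2)] \<rho>(1) by (simp add: tendsto_iff dist_norm o_def)
  moreover have "\<forall>\<^sub>F n in sequentially. c / 2 < j (u (r n)) \<bullet> j l"
    using order_tendstoD(1)[OF j_lim, of "c / 2"] c by simp
  moreover have "\<forall>\<^sub>F n in sequentially. \<bar>A' t (u (r n)) \<bullet> j l\<bar> < e * c / 8"
    using order_tendstoD(2)[OF tendsto_rabs_zero[OF A'_lim0], of "e * c / 8"] e c by simp
  ultimately have "\<forall>\<^sub>F n in sequentially. norm (s (r n) - t) < \<rho> \<and> c / 2 < j (u (r n)) \<bullet> j l
      \<and> \<bar>A' t (u (r n)) \<bullet> j l\<bar> < e * c / 8"
    by eventually_elim blast
  then obtain n where n: "norm (s (r n) - t) < \<rho>" "c / 2 < j (u (r n)) \<bullet> j l"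
      "\<bar>A' t (u (r n)) \<bullet> j l\<bar> < e * c / 8"
    by (auto dest: eventually_happens)
  define x y v where "x = s (r n) - t" and "y = d (r n) - \<delta>" and "v = u (r n)"
  define R where "R = A (s (r n)) - A t - x *\<^sub>R A' t"
  have Tv: "T v \<bullet> j l = 0"
    using sa l(1) unfolding T_def by (rule selfadjoint_op_kernel_orthogonal)
  \<comment> \<open>First-order expansion of the kernel equation at \<open>(t, \<delta>)\<close>;
    pairing with \<open>j l\<close> removes \<open>T v\<close> because \<open>l\<close> is in the
    kernel of \<open>T\<close>.\<close>
  have "T v + y *\<^sub>R j v + x *\<^sub>R A' t v + R v = (A (s (r n)) + d (r n) *\<^sub>R j) v"
    by (simp add: T_def R_def x_def y_def blinfun.bilinear_simps algebra_simps)
  then have "(T v + y *\<^sub>R j v + x *\<^sub>R A' t v + R v) \<bullet> j l = 0"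
    using ker[of "r n"] by (simp add: v_def)
  then have eq: "y * (j v \<bullet> j l) = - (x * (A' t v \<bullet> j l)) - R v \<bullet> j l"
    using Tv by (simp add: inner_add_left)
  have "\<bar>R v \<bullet> j l\<bar> \<le> norm (R v) * norm (j l)"
    by (rule Cauchy_Schwarz_ineq2)
  also have "norm (R v) \<le> norm R"
    using norm_blinfun[of R v] nu[of "r n"] by (simp add: v_def)
  also have "norm R \<le> \<eta> * \<bar>x\<bar>"
    using \<rho>(2)[OF s n(1)] by (simp add: R_def x_def)
  also have "\<eta> * \<bar>x\<bar> * norm (j l) \<le> \<bar>x\<bar> * (e * c / 8)"
    using mult_left_mono[OF \<eta>_jl, of "\<bar>x\<bar>"] by (simp add: mult_ac)
  finally have R: "\<bar>R v \<bullet> j l\<bar> \<le> \<bar>x\<bar> * (e * c / 8)"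
    by (simp add: mult_right_mono)
  have "\<bar>x * (A' t v \<bullet> j l)\<bar> \<le> \<bar>x\<bar> * (e * c / 8)"
    unfolding abs_mult v_def using n(3) by (intro mult_left_mono) auto
  with R eq have "\<bar>y * (j v \<bullet> j l)\<bar> \<le> \<bar>x\<bar> * (e * c / 8) + \<bar>x\<bar> * (e * c / 8)"
    by linarith
  also have "\<dots> = (e * \<bar>x\<bar>) * (c / 4)"
    by simp
  also have "\<dots> \<le> \<bar>y\<bar> * (c / 4)"
    using steep[of "r n"] c by (intro mult_right_mono) (auto simp: x_def y_def)
  finally have "\<bar>y\<bar> * (j v \<bullet> j l) \<le> \<bar>y\<bar> * (c / 4)"
    using n(2) c by (simp add: abs_mult v_def)
  moreover have "\<bar>y\<bar> > 0"
    using steep[of "r n"] mult_nonneg_nonneg[OF less_imp_le[OF e] abs_ge_zero[of x]] by (simp add: x_def y_def)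
  ultimately have "j v \<bullet> j l \<le> c / 4"
    by simp
  then show False
    using n(2) c by (simp add: v_def)
qed

text \<open>On the diagonal the polar form is the quadratic form itself, so a vector of the radical
  is isotropic.\<close>

lemma regular_crossing_if_anisotropic:
  assumes "crossing A t" "\<And>u. A t u = 0 \<Longrightarrow> crossing_form j A t u = 0 \<Longrightarrow> u = 0"
  shows "regular_crossing j A t"
  unfolding regular_crossing_def nondegenerate_on_def
proof (intro conjI ballI impI assms(1))
  fix u assume u: "u \<in> blinfun_kernel (A t)"
    and polar: "\<forall>v\<in>blinfun_kernel (A t). polar_form (crossing_form j A t) u v = 0"
  have "polar_form (crossing_form j A t) u u = crossing_form j A t u"
    by (simp add: polar_form_def crossing_form_def blinfun.add_right inner_add_left inner_add_right)
  with polar u have "crossing_form j A t u = 0"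
    by auto
  then show "u = 0"
    using assms(2) u by (simp add: blinfun_kernel_def)
qed

lemma fredholm_uniform_on_compact:
  fixes K :: "('a::{real_inner,banach} \<Rightarrow>\<^sub>L 'b::banach) set"
  assumes "compact K" "\<And>T. T \<in> K \<Longrightarrow> fredholm T"
  obtains r where "r > 0" "\<And>T S. T \<in> K \<Longrightarrow> norm (S - T) < r \<Longrightarrow> fredholm S"
proof -
  have "open {T :: 'a \<Rightarrow>\<^sub>L 'b. fredholm T}"
    unfolding open_dist
  proof
    fix T :: "'a \<Rightarrow>\<^sub>L 'b" assume "T \<in> {T. fredholm T}"
    then obtain r where "r > 0" "\<And>S. norm (S - T) < r \<Longrightarrow> fredholm S"
      using fredholm_perturbation by blast
    then show "\<exists>r>0. \<forall>S. dist S T < r \<longrightarrow> S \<in> {T. fredholm T}"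
      by (auto simp: dist_norm)
  qed
  \<comment> \<open>The uniform radius is a Lebesgue number of the cover of \<open>K\<close> by one
    open set.\<close>
  then obtain r where r: "r > 0" "\<And>T. T \<in> K \<Longrightarrow> \<exists>G\<in>{{T. fredholm T}}. ball T r \<subseteq> G"
    using Heine_Borel_lemma[OF assms(1), of "{{T. fredholm T}}"] assms(2) by auto
  have "fredholm S" if "T \<in> K" "norm (S - T) < r" for T S
  proof -
    have "S \<in> ball T r"
      using that(2) by (simp add: dist_norm norm_minus_commute)
    then show ?thesis
      using r(2)[OF that(1)] by blast
  qed
  then show thesis
    using that r(1) by blast
qed

theorem theorem2p6:
  fixes j :: "'w::{real_inner,banach} \<Rightarrow>\<^sub>L 'h::{real_inner,banach}"
    and A :: "real \<Rightarrow> 'w \<Rightarrow>\<^sub>L 'h"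
  assumes "inj (blinfun_apply j)"
    and "closure (range (blinfun_apply j)) = UNIV"
    and "C1_path A"
    and "path_image A \<subseteq> FS j"
  shows "\<exists>\<epsilon>>0.
           (\<forall>\<delta>. \<bar>\<delta>\<bar> < \<epsilon> \<longrightarrow> path (shift_path j A \<delta>) \<and> path_image (shift_path j A \<delta>) \<subseteq> FS j) \<and>
           (AE \<delta> in lebesgue. \<delta> \<in> {-\<epsilon><..<\<epsilon>} \<longrightarrow> only_regular_crossings j (shift_path j A \<delta>))"
proof -
  obtain A' where der: "\<And>t. t \<in> {0..1} \<Longrightarrow> (A has_vector_derivative A' t) (at t within {0..1})"
    and cont': "continuous_on {0..1} A'"
    using assms(3) unfolding C1_path_def by blast
  have cont: "continuous_on {0..1} A"
    using der has_vector_derivative_continuous unfolding continuous_on_eq_continuous_within by blast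
  have FS: "selfadjoint_op j (A t)" "fredholm (A t)" if "t \<in> {0..1}" for t
    using assms(4) that unfolding path_image_def FS_def by blast+
  have "compact (A ` {0..1})"
    using cont by (rule compact_continuous_image) simp
  then obtain r where r: "r > 0" "\<And>T S. T \<in> A ` {0..1} \<Longrightarrow> norm (S - T) < r \<Longrightarrow> fredholm S"
    using fredholm_uniform_on_compact[of "A ` {0..1}"] FS(2) by blast
  \<comment> \<open>Then \<open>\<bar>\<delta>\<bar> < \<epsilon>\<close> gives
    \<open>norm (\<delta> *\<^sub>R j) < r\<close>; the summand 1 keeps the denominator
    positive.\<close>
  define \<epsilon> where "\<epsilon> = r / (norm j + 1)"
  have j1: "norm j + 1 > 0"
    using norm_ge_zero[of j] by linarith
  have "\<epsilon> > 0"
    unfolding \<epsilon>_def using r(1) j1 by simp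
  have sa: "selfadjoint_op j (A t + \<delta> *\<^sub>R j)" if "t \<in> {0..1}" for t \<delta>
    using FS(1)[OF that] by (rule selfadjoint_op_shift)
  have fr: "fredholm (A t + \<delta> *\<^sub>R j)" if "t \<in> {0..1}" "\<bar>\<delta>\<bar> < \<epsilon>" for t \<delta>
  proof (rule r(2))
    show "A t \<in> A ` {0..1}"
      using that(1) by blast
    have "\<bar>\<delta>\<bar> * norm j \<le> \<bar>\<delta>\<bar> * (norm j + 1)"
      by (intro mult_left_mono) auto
    also have "\<dots> < \<epsilon> * (norm j + 1)"
      using that(2) j1 by (rule mult_strict_right_mono)
    also have "\<dots> = r"
      using j1 by (simp add: \<epsilon>_def)
    finally show "norm (A t + \<delta> *\<^sub>R j - A t) < r"
      by simp
  qed
  \<comment> \<open>In this strip the shifted operators are Fredholm, so the slope estimate holds at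
    every point of \<open>G\<close>.\<close>
  define G where "G = isotropic_crossings j A A' \<inter> {0..1} \<times> {-\<epsilon><..<\<epsilon>}"
  have "negligible (snd ` G)"
  proof (rule negligible_snd_image_horizontal)
    fix p and e :: real assume p: "p \<in> G" and "e > 0"
    obtain t \<delta> where [simp]: "p = (t, \<delta>)"
      by (cases p)
    have t: "t \<in> {0..1}" and "\<bar>\<delta>\<bar> < \<epsilon>"
      using p by (auto simp: G_def)
    then obtain \<rho> where "\<rho> > 0"
      "\<forall>q\<in>isotropic_crossings j A A'. dist q (t, \<delta>) < \<rho> \<longrightarrow> \<bar>snd q - \<delta>\<bar> \<le> e * \<bar>fst q - t\<bar>"
      using isotropic_crossings_horizontal[OF assms(1) t der[OF t] cont' sa fr \<open>e > 0\<close>] by blast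
    then show "\<exists>r>0. \<forall>q\<in>G. dist q p < r \<longrightarrow> \<bar>snd q - snd p\<bar> \<le> e * \<bar>fst q - fst p\<bar>"
      by (auto simp: G_def)
  qed
  then have "snd ` G \<in> null_sets lebesgue"
    by (simp add: negligible_iff_null_sets)
  then have "AE \<delta> in lebesgue. \<delta> \<notin> snd ` G"
    by (rule AE_not_in)
  then have "AE \<delta> in lebesgue. \<delta> \<in> {-\<epsilon><..<\<epsilon>} \<longrightarrow> only_regular_crossings j (shift_path j A \<delta>)"
  proof (eventually_elim, intro impI)
    fix \<delta> assume notin: "\<delta> \<notin> snd ` G" and \<delta>: "\<delta> \<in> {-\<epsilon><..<\<epsilon>}"
    show "only_regular_crossings j (shift_path j A \<delta>)"
      unfolding only_regular_crossings_def
    proof (intro allI impI)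
      fix t assume cr: "crossing (shift_path j A \<delta>) t"
      then have t: "t \<in> {0..1}"
        by (simp add: crossing_def)
      \<comment> \<open>The shift is constant in \<open>t\<close>, so one and the same
        \<open>A'\<close> defines the crossing forms for all \<open>\<delta>\<close>.\<close>
      have "((\<lambda>t. A t + \<delta> *\<^sub>R j) has_vector_derivative A' t) (at t within {0..1})"
        using has_vector_derivative_add[OF der[OF t] has_vector_derivative_const] by simp
      then have "path_deriv (shift_path j A \<delta>) t = A' t"
        unfolding path_deriv_def shift_path_def
        using vector_derivative_within_cbox[OF zero_less_one, unfolded cbox_interval, OF t] by blast
      moreover have "(t, \<delta>) \<notin> isotropic_crossings j A A'"
        using notin \<delta> t by (force simp: G_def)
      ultimately show "regular_crossing j (shift_path j A \<delta>) t"
        using cr t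
        by (intro regular_crossing_if_anisotropic)
          (auto simp: isotropic_crossings_def crossing_form_def shift_path_def)
    qed
  qed
  moreover have "path (shift_path j A \<delta>)" for \<delta>
    unfolding path_def shift_path_def by (intro continuous_intros cont)
  moreover have "path_image (shift_path j A \<delta>) \<subseteq> FS j" if "\<bar>\<delta>\<bar> < \<epsilon>" for \<delta>
    using sa fr that by (auto simp: path_image_def shift_path_def FS_def)
  ultimately show ?thesis
    using \<open>\<epsilon> > 0\<close> by blast
qed

end
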